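(* Let $\mathcal{X}$ be a countably infinite linear ordering. Then the following are equivalent: (1) $\mathcal{X}$ is $2$-sunflowerable; (2) $\mathcal{X}$ is sunflowerable; (3) at least one of the following holds: $\mathcal{X}$ is isomorphic to $(\omega,\leq)$; $\mathcal{X}$ is isomorphic to $(\omega^*,\leq)$; $(\mathbb{Q},\leq)$ embeds into $\mathcal{X}$.
   Context: $\omega^*$ denotes the reverse of the ordering $\omega$. A set $Y$ of finite sets is a sunflower if there is a set $r$ such that $p\cap q=r$ for all distinct $p,q\in Y$. For $n\in\omega$, an infinite structure $\mathcal{M}$ is $n$-sunflowerable if for every structure $\mathcal{Y}\cong\mathcal{M}$ all of whose elements are sets of size $n$, there is a substructure $\mathcal{Z}\subseteq\mathcal{Y}$ with $\mathcal{Z}\cong\mathcal{Y}$ whose underlying set $Z$ is a sunflower. $\mathcal{M}$ is sunflowerable if it is $n$-sunflowerable for every $n\in\omega$. *)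

theory Defs
  imports Main "HOL.Rat" "HOL-Library.Countable_Set"
begin

(* Structures in the signature of orderings are given by a universe A together with a
   binary relation r on A. *)

definition embedding :: "'a set \<Rightarrow> 'a rel \<Rightarrow> 'b set \<Rightarrow> 'b rel \<Rightarrow> ('a \<Rightarrow> 'b) \<Rightarrow> bool" where
  "embedding A r B s f \<longleftrightarrow>
     inj_on f A \<and> f ` A \<subseteq> B \<and> (\<forall>x\<in>A. \<forall>y\<in>A. (x, y) \<in> r \<longleftrightarrow> (f x, f y) \<in> s)"

definition embeds :: "'a set \<Rightarrow> 'a rel \<Rightarrow> 'b set \<Rightarrow> 'b rel \<Rightarrow> bool" where
  "embeds A r B s \<longleftrightarrow> (\<exists>f. embedding A r B s f)"

definition isomorphic :: "'a set \<Rightarrow> 'a rel \<Rightarrow> 'b set \<Rightarrow> 'b rel \<Rightarrow> bool" where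
  "isomorphic A r B s \<longleftrightarrow> (\<exists>f. embedding A r B s f \<and> f ` A = B)"

definition substructure :: "'a set \<Rightarrow> 'a rel \<Rightarrow> 'a set \<Rightarrow> 'a rel \<Rightarrow> bool" where
  "substructure B s A r \<longleftrightarrow> B \<subseteq> A \<and> s = r \<inter> B \<times> B"

definition sunflower :: "'b set set \<Rightarrow> bool" where
  "sunflower Y \<longleftrightarrow>
     (\<forall>p\<in>Y. finite p) \<and> (\<exists>r. \<forall>p\<in>Y. \<forall>q\<in>Y. p \<noteq> q \<longrightarrow> p \<inter> q = r)"

(* The type argument 'b is the type of points from which the n-element sets are formed,
   since a definition cannot quantify over types. It has to be infinite to be meaningful:
   over a finite 'b there is no infinite structure of sets and the condition is vacuous.
   Finiteness of p is explicit because card is 0 on infinite sets. *)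
definition n_sunflowerable :: "'b itself \<Rightarrow> nat \<Rightarrow> 'a set \<Rightarrow> 'a rel \<Rightarrow> bool" where
  "n_sunflowerable T n A r \<longleftrightarrow>
     (\<forall>(Y :: 'b set set) s.
        s \<subseteq> Y \<times> Y \<and> isomorphic Y s A r \<and> (\<forall>p\<in>Y. finite p \<and> card p = n) \<longrightarrow>
        (\<exists>Z t. substructure Z t Y s \<and> isomorphic Z t Y s \<and> sunflower Z))"

definition sunflowerable :: "'b itself \<Rightarrow> 'a set \<Rightarrow> 'a rel \<Rightarrow> bool" where
  "sunflowerable T A r \<longleftrightarrow> (\<forall>n. n_sunflowerable T n A r)"

definition omega_le :: "nat rel" where
  "omega_le = {(m, n). m \<le> n}"

definition rat_le :: "rat rel" where
  "rat_le = {(p, q). p \<le> q}"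

end

theory Submission
  imports Defs "HOL-Library.Infinite_Set"
begin

text \<open>For the sunflowers, both the naturals and the rationals are indivisible, so induction on the size
  of the sets works: either some point lies in the sets indexed by a copy of the order, and it is
  removed, or any finite set of points meets only a small part of the family, and a pairwise
  disjoint copy is chosen greedily. Every countable order embeds into the rationals.

  Conversely, let \<open>X\<close> be 2-sunflowerable. Applied to disjoint unions of stars, this makes every
  colouring of \<open>X\<close> constant or injective on a copy of \<open>X\<close>; in particular \<open>X\<close> is indivisible. If
  \<open>X\<close> contains no copy of the rationals, the colouring by the classes of ``\<open>X\<close> does not embed
  into \<open>[x, y]\<close>'' shows that \<open>X\<close> embeds into no bounded interval. By indivisibility \<open>X\<close> embeds
  above or below a given point; say above, and then it embeds into no proper initial segment.
  Colouring along a cofinal sequence embeds \<open>X\<close> into the naturals.\<close>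

section \<open>Embeddings and isomorphisms of orders\<close>

lemma embedding_compose:
  assumes "embedding A r B s f" "embedding B s C t g"
  shows "embedding A r C t (g \<circ> f)"
proof -
  have "inj_on (g \<circ> f) A"
    using assms unfolding embedding_def by (meson comp_inj_on inj_on_subset)
  moreover have "(g \<circ> f) ` A \<subseteq> C"
    using assms unfolding embedding_def by (auto simp: image_subset_iff)
  moreover have "\<forall>x\<in>A. \<forall>y\<in>A. (x, y) \<in> r \<longleftrightarrow> ((g \<circ> f) x, (g \<circ> f) y) \<in> t"
    using assms unfolding embedding_def by (auto simp: image_subset_iff)
  ultimately show ?thesis
    unfolding embedding_def by blast
qed

lemma embedding_converse: "embedding A (r\<inverse>) B (s\<inverse>) f \<longleftrightarrow> embedding A r B s f"
  unfolding embedding_def by auto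

lemma embeds_converse: "embeds A (r\<inverse>) B (s\<inverse>) \<longleftrightarrow> embeds A r B s"
  unfolding embeds_def embedding_converse ..

lemma embedding_subset: "embedding A r B s f \<Longrightarrow> f ` A \<subseteq> C \<Longrightarrow> embedding A r C s f"
  by (simp add: embedding_def)

lemma embeds_mono: "embeds A r B s \<Longrightarrow> B \<subseteq> C \<Longrightarrow> embeds A r C s"
  unfolding embeds_def embedding_def by (meson subset_trans)

lemma embedding_strict:
  assumes "embedding A r B s f" "x \<in> A" "y \<in> A" "(x, y) \<in> r" "x \<noteq> y"
  shows "(f x, f y) \<in> s" "f x \<noteq> f y"
  using assms unfolding embedding_def inj_on_def by auto

text \<open>Totality of \<open>r\<close> and antisymmetry of \<open>s\<close> turn preservation of
  strict pairs into injectivity and reflection; pairs of equal points are covered by reflexivity on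
  both sides.\<close>

lemma embeddingI_strict:
  assumes r: "linear_order_on A r" and s: "linear_order_on B s" and fB: "f ` A \<subseteq> B"
    and mono: "\<And>x y. x \<in> A \<Longrightarrow> y \<in> A \<Longrightarrow> (x, y) \<in> r \<Longrightarrow> x \<noteq> y \<Longrightarrow> (f x, f y) \<in> s \<and> f x \<noteq> f y"
  shows "embedding A r B s f"
proof -
  have tot: "(x, y) \<in> r \<or> (y, x) \<in> r" if "x \<in> A" "y \<in> A" "x \<noteq> y" for x y
    using r that unfolding linear_order_on_def total_on_def by blast
  have anti: "x = y" if "(x, y) \<in> s" "(y, x) \<in> s" for x y
    using s that unfolding linear_order_on_def partial_order_on_def antisym_def by blast
  have "inj_on f A"
    using tot mono by (metis inj_onI)
  moreover have "(x, y) \<in> r \<longleftrightarrow> (f x, f y) \<in> s" if "x \<in> A" "y \<in> A" for x y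
  proof (cases "x = y")
    case True
    then show ?thesis
      using r s that fB
      unfolding linear_order_on_def partial_order_on_def preorder_on_def refl_on_def by auto
  next
    case False
    then show ?thesis
      using tot[OF that] mono that anti by metis
  qed
  ultimately show ?thesis
    unfolding embedding_def using fB by blast
qed

lemma isomorphic_embeds: "isomorphic A r B s \<Longrightarrow> embeds A r B s"
  unfolding isomorphic_def embeds_def by blast

lemma isomorphic_sym:
  assumes "isomorphic A r B s"
  shows "isomorphic B s A r"
proof -
  obtain f where f: "embedding A r B s f" "f ` A = B"
    using assms unfolding isomorphic_def by blast
  then have bij: "bij_betw f A B"
    unfolding embedding_def bij_betw_def by blast
  define g where "g = the_inv_into A f"
  have g: "bij_betw g B A"
    unfolding g_def using bij by (rule bij_betw_the_inv_into)
  have fg: "f (g y) = y" if "y \<in> B" for y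
    using bij that unfolding g_def by (rule f_the_inv_into_f_bij_betw)
  have "(x, y) \<in> s \<longleftrightarrow> (g x, g y) \<in> r" if "x \<in> B" "y \<in> B" for x y
    using f(1) fg that bij_betwE[OF g] unfolding embedding_def by metis
  then show ?thesis
    unfolding isomorphic_def embedding_def using g by (auto simp: bij_betw_def intro!: exI[of _ g])
qed

lemma isomorphic_trans:
  assumes "isomorphic A r B s" "isomorphic B s C t"
  shows "isomorphic A r C t"
  using assms unfolding isomorphic_def by (metis embedding_compose image_comp)

lemma isomorphic_converse: "isomorphic A (r\<inverse>) B (s\<inverse>) \<longleftrightarrow> isomorphic A r B s"
  unfolding isomorphic_def embedding_converse ..

lemma linear_omega: "linear_order_on UNIV omega_le"
  unfolding omega_le_def linear_order_on_def partial_order_on_def preorder_on_def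
    refl_on_def trans_def antisym_def total_on_def by auto

lemma linear_rat: "linear_order_on UNIV rat_le"
  unfolding rat_le_def linear_order_on_def partial_order_on_def preorder_on_def
    refl_on_def trans_def antisym_def total_on_def by auto

lemma rat_le_strict: "(x, y) \<in> rat_le \<and> x \<noteq> y \<longleftrightarrow> x < y"
  by (auto simp: rat_le_def)

text \<open>The image is an infinite set of naturals, and listing it in increasing order identifies
  it with all of them.\<close>

lemma isomorphic_omega_if_embeds:
  assumes "embedding X le UNIV omega_le f" "infinite X"
  shows "isomorphic X le UNIV omega_le"
proof -
  let ?S = "f ` X"
  have inf: "infinite ?S"
    using assms unfolding embedding_def by (simp add: finite_image_iff)
  have "isomorphic X le ?S omega_le"
    using assms(1) unfolding isomorphic_def embedding_def by blast
  moreover have "isomorphic UNIV omega_le ?S omega_le"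
    unfolding isomorphic_def embedding_def
    using bij_enumerate[OF inf] strict_mono_less_eq[OF strict_mono_enumerate[OF inf]]
    by (auto simp: bij_betw_def omega_le_def intro!: exI[of _ "enumerate ?S"])
  ultimately show ?thesis
    by (metis isomorphic_sym isomorphic_trans)
qed

text \<open>Structures of sets are traded for families indexed by \<open>X\<close>. A structure of
  \<open>n\<close>-element sets isomorphic to \<open>X\<close> amounts to an injective family
  \<open>h\<close> carrying the transported order, and an isomorphic substructure of it is the image
  under \<open>h\<close> of a self-embedding \<open>g\<close>.\<close>

lemma n_sunflowerable_iff:
  "n_sunflowerable TYPE('b) n X le \<longleftrightarrow>
     (\<forall>h :: 'a \<Rightarrow> 'b set. inj_on h X \<and> (\<forall>x\<in>X. finite (h x) \<and> card (h x) = n) \<longrightarrow>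
        (\<exists>g r. embedding X le X le g \<and> (\<forall>x\<in>X. \<forall>y\<in>X. x \<noteq> y \<longrightarrow> h (g x) \<inter> h (g y) = r)))"
    (is "?L \<longleftrightarrow> ?R")
proof
  assume L: ?L
  show ?R
  proof (intro allI impI)
    fix h :: "'a \<Rightarrow> 'b set"
    assume h: "inj_on h X \<and> (\<forall>x\<in>X. finite (h x) \<and> card (h x) = n)"
    define s where "s = {(p, q). \<exists>x\<in>X. \<exists>y\<in>X. p = h x \<and> q = h y \<and> (x, y) \<in> le}"
    have "(x, y) \<in> le \<longleftrightarrow> (h x, h y) \<in> s" if "x \<in> X" "y \<in> X" for x y
      using h that unfolding s_def by (auto simp: inj_on_eq_iff)
    then have emb: "embedding X le (h ` X) s h"
      using h unfolding embedding_def by simp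
    then have "isomorphic (h ` X) s X le"
      by (metis isomorphic_def isomorphic_sym)
    moreover have "s \<subseteq> h ` X \<times> h ` X"
      unfolding s_def by blast
    moreover have "\<forall>p\<in>h ` X. finite p \<and> card p = n"
      using h by blast
    ultimately obtain Z t where Z: "substructure Z t (h ` X) s" "isomorphic Z t (h ` X) s" "sunflower Z"
      using L unfolding n_sunflowerable_def by meson
    have "isomorphic X le Z t"
      using isomorphic_sym[OF isomorphic_trans[OF Z(2) \<open>isomorphic (h ` X) s X le\<close>]] .
    then obtain f where f: "embedding X le Z t f" "f ` X = Z"
      unfolding isomorphic_def by blast
    obtain r where r: "\<forall>p\<in>Z. \<forall>q\<in>Z. p \<noteq> q \<longrightarrow> p \<inter> q = r"
      using Z(3) unfolding sunflower_def by blast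
    have "f x \<in> h ` X" if "x \<in> X" for x
      using f(2) Z(1) that unfolding substructure_def by auto
    then have "\<forall>x\<in>X. \<exists>y. y \<in> X \<and> h y = f x"
      by (metis imageE)
    \<comment> \<open>Every \<open>f x\<close> lies in \<open>Z\<close> and so is a value of
      \<open>h\<close>; pulling it back along \<open>h\<close> turns the copy \<open>Z\<close> into
      a self-embedding of \<open>X\<close>.\<close>
    then obtain g where g: "\<And>x. x \<in> X \<Longrightarrow> g x \<in> X \<and> h (g x) = f x"
      by metis
    have le: "(x, y) \<in> le \<longleftrightarrow> (g x, g y) \<in> le" if "x \<in> X" "y \<in> X" for x y
    proof -
      have "(x, y) \<in> le \<longleftrightarrow> (f x, f y) \<in> s"
        using f that Z(1) unfolding embedding_def substructure_def by auto
      also have "\<dots> \<longleftrightarrow> (g x, g y) \<in> le"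
        using emb g[OF that(1)] g[OF that(2)] unfolding embedding_def by metis
      finally show ?thesis .
    qed
    have inj: "f x \<noteq> f y" if "x \<in> X" "y \<in> X" "x \<noteq> y" for x y
      using f(1) that unfolding embedding_def inj_on_def by blast
    then have "inj_on g X"
      using g by (metis inj_onI)
    then have "embedding X le X le g"
      unfolding embedding_def using g le by auto
    moreover have "h (g x) \<inter> h (g y) = r" if "x \<in> X" "y \<in> X" "x \<noteq> y" for x y
      using r f(2) inj[OF that] that g by auto
    ultimately show "\<exists>g r. embedding X le X le g \<and> (\<forall>x\<in>X. \<forall>y\<in>X. x \<noteq> y \<longrightarrow> h (g x) \<inter> h (g y) = r)"
      by (intro exI[of _ g] exI[of _ r] conjI ballI impI)
  qed
next
  assume R: ?R
  show ?L
    unfolding n_sunflowerable_def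
  proof (intro allI impI)
    fix Y :: "'b set set" and s
    assume Y: "s \<subseteq> Y \<times> Y \<and> isomorphic Y s X le \<and> (\<forall>p\<in>Y. finite p \<and> card p = n)"
    then obtain h where h: "embedding X le Y s h" "h ` X = Y"
      by (metis isomorphic_sym isomorphic_def)
    moreover have "inj_on h X \<and> (\<forall>x\<in>X. finite (h x) \<and> card (h x) = n)"
      using h Y unfolding embedding_def by blast
    ultimately obtain g r where g: "embedding X le X le g"
      and r: "\<And>x y. x \<in> X \<Longrightarrow> y \<in> X \<Longrightarrow> x \<noteq> y \<Longrightarrow> h (g x) \<inter> h (g y) = r"
      using R by meson
    define Z where "Z = (h \<circ> g) ` X"
    have hg: "embedding X le Y s (h \<circ> g)"
      using g h(1) by (rule embedding_compose)
    have sub: "substructure Z (s \<inter> Z \<times> Z) Y s"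
      using hg unfolding substructure_def embedding_def Z_def by blast
    have "isomorphic X le Z (s \<inter> Z \<times> Z)"
      using hg unfolding isomorphic_def embedding_def Z_def by (intro exI[of _ "h \<circ> g"]) auto
    moreover have "isomorphic X le Y s"
      using h unfolding isomorphic_def by blast
    ultimately have iso: "isomorphic Z (s \<inter> Z \<times> Z) Y s"
      by (metis isomorphic_sym isomorphic_trans)
    have "p \<inter> q = r" if pq: "p \<in> Z" "q \<in> Z" "p \<noteq> q" for p q
      using pq r unfolding Z_def by auto
    moreover have "finite p" if "p \<in> Z" for p
      using sub Y that unfolding substructure_def by blast
    ultimately have "sunflower Z"
      unfolding sunflower_def by (intro conjI exI[of _ r] ballI impI)
    with sub iso show "\<exists>Z t. substructure Z t Y s \<and> isomorphic Z t Y s \<and> sunflower Z"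
      by (intro exI conjI)
  qed
qed

section \<open>Greedy embeddings of countable orders\<close>

text \<open>The points of \<open>A\<close> are placed one at a time along an enumeration.
  \<open>L\<close> and \<open>U\<close> are the values already given to points below and above the
  current one, and \<open>step\<close> may assume of them all that the construction guarantees so
  far. \<open>T\<close> is an arbitrary relation, so that further requirements can be imposed
  together with the order.\<close>

lemma greedy_embedding:
  fixes T :: "'c \<Rightarrow> 'c \<Rightarrow> bool"
  assumes lin: "linear_order_on A r" and cnt: "countable A"
    and step: "\<And>L U. finite L \<Longrightarrow> finite U \<Longrightarrow> L \<union> U \<subseteq> B \<Longrightarrow> (\<And>l u. l \<in> L \<Longrightarrow> u \<in> U \<Longrightarrow> T l u) \<Longrightarrow>
      (\<And>x y. x \<in> L \<union> U \<Longrightarrow> y \<in> L \<union> U \<Longrightarrow> x \<noteq> y \<Longrightarrow> T x y \<or> T y x) \<Longrightarrow>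
      \<exists>c\<in>B. (\<forall>l\<in>L. T l c) \<and> (\<forall>u\<in>U. T c u)"
  shows "\<exists>g. g ` A \<subseteq> B \<and> (\<forall>x\<in>A. \<forall>y\<in>A. (x, y) \<in> r \<and> x \<noteq> y \<longrightarrow> T (g x) (g y))"
proof -
  define m where "m = to_nat_on A"
  have m: "inj_on m A"
    unfolding m_def using cnt by (rule inj_on_to_nat_on)
  \<comment> \<open>\<open>P f x c\<close> says that \<open>c\<close> is an admissible value at
    \<open>x\<close>, given the values of \<open>f\<close> at points enumerated earlier. It looks at
    no other values of \<open>f\<close>, as well-founded choice requires; outside \<open>A\<close>
    every value is admissible.\<close>
  define P where "P f x c \<longleftrightarrow> (x \<in> A \<longrightarrow> c \<in> B \<and> (\<forall>y\<in>A. m y < m x \<longrightarrow>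
      ((y, x) \<in> r \<longrightarrow> T (f y) c) \<and> ((x, y) \<in> r \<longrightarrow> T c (f y))))" for f x c
  have tot: "(x, y) \<in> r \<or> (y, x) \<in> r" if "x \<in> A" "y \<in> A" "x \<noteq> y" for x y
    using lin that unfolding linear_order_on_def total_on_def by blast
  have "trans r" "antisym r"
    using lin unfolding linear_order_on_def partial_order_on_def preorder_on_def by auto
  have "\<exists>f. \<forall>x. P f x (f x)"
  proof (rule dependent_wf_choice[OF wf_measure[of m]])
    fix f g :: "'a \<Rightarrow> 'c" and x c
    assume "\<And>z. (z, x) \<in> measure m \<Longrightarrow> f z = g z"
    then show "P f x c = P g x c"
      unfolding P_def by auto
  next
    fix x f
    assume IH: "\<And>y. (y, x) \<in> measure m \<Longrightarrow> P f y (f y)"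
    define E where "E = {y \<in> A. m y < m x}"
    have "finite E"
      using m unfolding E_def
      by (intro finite_imageD[of m]) (auto intro: finite_subset[of _ "{..<m x}"] inj_on_subset)
    \<comment> \<open>Whichever of \<open>y\<close> and \<open>z\<close> was placed later had to
      respect the other one.\<close>
    have fT: "T (f y) (f z)" if "y \<in> E" "z \<in> E" "y \<noteq> z" "(y, z) \<in> r" for y z
    proof -
      have "m y \<noteq> m z"
        using m that unfolding E_def inj_on_def by blast
      then consider "m y < m z" | "m z < m y"
        by linarith
      then show ?thesis
        using IH[of y] IH[of z] that unfolding P_def E_def by cases auto
    qed
    show "\<exists>c. P f x c"
    proof (cases "x \<in> A")
      case True
      define L U where "L = f ` {y \<in> E. (y, x) \<in> r}" and "U = f ` {y \<in> E. (x, y) \<in> r}"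
      have ne: "y \<noteq> x" if "y \<in> E" for y
        using that unfolding E_def by auto
      have "\<exists>c\<in>B. (\<forall>l\<in>L. T l c) \<and> (\<forall>u\<in>U. T c u)"
      proof (rule step)
        show "finite L" "finite U"
          unfolding L_def U_def using \<open>finite E\<close> by auto
        show "L \<union> U \<subseteq> B"
          unfolding L_def U_def using IH by (auto simp: P_def E_def)
      next
        fix l u assume "l \<in> L" "u \<in> U"
        then obtain y z where yz: "y \<in> E" "(y, x) \<in> r" "l = f y" "z \<in> E" "(x, z) \<in> r" "u = f z"
          unfolding L_def U_def by blast
        then have "(y, z) \<in> r" "y \<noteq> z"
          using \<open>trans r\<close> \<open>antisym r\<close> ne unfolding trans_def antisym_def by blast+
        then show "T l u"
          using fT yz by blast
      next
        fix a b assume "a \<in> L \<union> U" "b \<in> L \<union> U" "a \<noteq> b"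
        then obtain y z where "y \<in> E" "z \<in> E" "a = f y" "b = f z" "y \<noteq> z"
          unfolding L_def U_def by blast
        then show "T a b \<or> T b a"
          using fT tot unfolding E_def by blast
      qed
      then obtain c where "c \<in> B" "\<forall>l\<in>L. T l c" "\<forall>u\<in>U. T c u"
        by blast
      then have "P f x c"
        unfolding P_def L_def U_def E_def by simp
      then show ?thesis ..
    qed (auto simp: P_def)
  qed
  then obtain f where f: "\<And>x. P f x (f x)"
    by blast
  have "T (f x) (f y)" if "x \<in> A" "y \<in> A" "(x, y) \<in> r" "x \<noteq> y" for x y
  proof -
    have "m x \<noteq> m y"
      using m that unfolding inj_on_def by blast
    then consider "m x < m y" | "m y < m x"
      by linarith
    then show ?thesis
      using f[of x] f[of y] that unfolding P_def by cases auto
  qed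
  moreover have "f ` A \<subseteq> B"
    using f unfolding P_def by blast
  ultimately show ?thesis
    by blast
qed

lemma greedy_embedding_rat:
  fixes T :: "'c \<Rightarrow> 'c \<Rightarrow> bool"
  assumes "\<And>L U. finite L \<Longrightarrow> finite U \<Longrightarrow> L \<union> U \<subseteq> B \<Longrightarrow> (\<And>l u. l \<in> L \<Longrightarrow> u \<in> U \<Longrightarrow> T l u) \<Longrightarrow>
      (\<And>x y. x \<in> L \<union> U \<Longrightarrow> y \<in> L \<union> U \<Longrightarrow> x \<noteq> y \<Longrightarrow> T x y \<or> T y x) \<Longrightarrow>
      \<exists>c\<in>B. (\<forall>l\<in>L. T l c) \<and> (\<forall>u\<in>U. T c u)"
  obtains g :: "rat \<Rightarrow> 'c" where "range g \<subseteq> B" "\<And>x y. x < y \<Longrightarrow> T (g x) (g y)"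
proof -
  have "\<exists>g. g ` UNIV \<subseteq> B \<and> (\<forall>x\<in>UNIV. \<forall>y\<in>UNIV. (x, y) \<in> rat_le \<and> x \<noteq> y \<longrightarrow> T (g x) (g y))"
    by (rule greedy_embedding[OF linear_rat _ assms]) simp
  then obtain g :: "rat \<Rightarrow> 'c" where "range g \<subseteq> B" "\<forall>x\<in>UNIV. \<forall>y\<in>UNIV. x < y \<longrightarrow> T (g x) (g y)"
    unfolding rat_le_strict by blast
  then show ?thesis
    by (intro that[of g]) simp_all
qed

section \<open>Sunflowers in families indexed by an indivisible order\<close>

definition contains_copy :: "'q::linorder set \<Rightarrow> bool" where
  "contains_copy A \<longleftrightarrow> (\<exists>g :: 'q \<Rightarrow> 'q. strict_mono g \<and> range g \<subseteq> A)"

text \<open>The argument common to the naturals and the rationals. \<open>indivisible\<close> makes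
  the sets without a copy closed under finite unions; \<open>independent\<close> is the greedy
  choice, available as soon as finitely many points conflict only with a set containing no
  copy.\<close>

lemma sunflower_subfamily:
  fixes h :: "'q::linorder \<Rightarrow> 'b set"
  assumes indivisible: "\<And>A B :: 'q set. contains_copy (A \<union> B) \<Longrightarrow> contains_copy A \<or> contains_copy B"
    and independent: "\<And>T :: 'q \<Rightarrow> 'q \<Rightarrow> bool. symp T \<Longrightarrow>
      (\<And>F. finite F \<Longrightarrow> \<not> contains_copy {q. \<exists>p\<in>F. \<not> T p q}) \<Longrightarrow>
      \<exists>g :: 'q \<Rightarrow> 'q. strict_mono g \<and> (\<forall>p q. p < q \<longrightarrow> T (g p) (g q))"
    and h: "\<And>q. finite (h q) \<and> card (h q) = n"
  shows "\<exists>(g :: 'q \<Rightarrow> 'q) r. strict_mono g \<and> (\<forall>p q. p \<noteq> q \<longrightarrow> h (g p) \<inter> h (g q) = r)"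
  using h
proof (induction n arbitrary: h)
  case 0
  then have "h p \<inter> h q = {}" for p q
    by (metis card_0_eq inf_bot_left)
  moreover have "strict_mono (\<lambda>q :: 'q. q)"
    by (simp add: strict_mono_def)
  ultimately show ?case
    by blast
next
  case (Suc n)
  show ?case
  proof (cases "\<exists>x. contains_copy {q. x \<in> h q}")
    case True
    then obtain x and g :: "'q \<Rightarrow> 'q" where g: "strict_mono g" "\<And>q. x \<in> h (g q)"
      unfolding contains_copy_def by blast
    have "finite (h (g q) - {x}) \<and> card (h (g q) - {x}) = n" for q
      using Suc.prems[of "g q"] g(2)[of q] by simp
    then obtain g' :: "'q \<Rightarrow> 'q" and r where g': "strict_mono g'"
      and r: "\<And>p q. p \<noteq> q \<Longrightarrow> (h (g (g' p)) - {x}) \<inter> (h (g (g' q)) - {x}) = r"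
      using Suc.IH[of "\<lambda>q. h (g q) - {x}"] by blast
    \<comment> \<open>The removed point \<open>x\<close> lies in all sets of the subfamily, so it
      returns to the kernel.\<close>
    have "h ((g \<circ> g') p) \<inter> h ((g \<circ> g') q) = insert x r" if "p \<noteq> q" for p q
      using r[OF that] g(2)[of "g' p"] g(2)[of "g' q"] by auto
    moreover have "strict_mono (g \<circ> g')"
      using g(1) g' by (simp add: strict_mono_def)
    ultimately show ?thesis
      by blast
  next
    case False
    have fin: "\<not> contains_copy {q. h q \<inter> F \<noteq> {}}" if "finite F" for F
      using that
    proof (induction F)
      case empty
      then show ?case by (auto simp: contains_copy_def)
    next
      case (insert x F)
      have "{q. h q \<inter> insert x F \<noteq> {}} = {q. x \<in> h q} \<union> {q. h q \<inter> F \<noteq> {}}"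
        by auto
      then show ?case
        using indivisible False insert.IH by metis
    qed
    \<comment> \<open>The sets indexed by \<open>F\<close> have a finite union, and a set conflicts
      with one of them exactly when it meets this union.\<close>
    have "\<not> contains_copy {q. \<exists>p\<in>F. \<not> h p \<inter> h q = {}}" if "finite F" for F
    proof -
      have "{q. \<exists>p\<in>F. \<not> h p \<inter> h q = {}} = {q. h q \<inter> \<Union>(h ` F) \<noteq> {}}"
        by blast
      then show ?thesis
        using fin[of "\<Union>(h ` F)"] that Suc.prems by simp
    qed
    then obtain g :: "'q \<Rightarrow> 'q" where g: "strict_mono g" "\<And>p q. p < q \<Longrightarrow> h (g p) \<inter> h (g q) = {}"
      using independent[of "\<lambda>p q. h p \<inter> h q = {}"] by (auto simp: symp_def Int_commute)
    then have "h (g p) \<inter> h (g q) = {}" if "p \<noteq> q" for p q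
      using that by (metis Int_commute linorder_neqE)
    with g(1) show ?thesis
      by blast
  qed
qed

lemma contains_copy_nat: "contains_copy A \<longleftrightarrow> infinite (A :: nat set)"
proof
  assume "contains_copy A"
  then obtain g :: "nat \<Rightarrow> nat" where "strict_mono g" "range g \<subseteq> A"
    unfolding contains_copy_def by blast
  then show "infinite A"
    using range_inj_infinite strict_mono_imp_inj_on finite_subset by metis
next
  assume "infinite A"
  then show "contains_copy A"
    unfolding contains_copy_def
    by (intro exI[of _ "enumerate A"]) (auto simp: strict_mono_enumerate enumerate_in_set)
qed

text \<open>Here containing a copy means being infinite, so finitely many earlier values rule out
  only finitely many candidates for the next one.\<close>

lemma sunflower_subfamily_nat:
  fixes h :: "nat \<Rightarrow> 'b set"
  assumes "\<And>q. finite (h q) \<and> card (h q) = n"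
  shows "\<exists>(g :: nat \<Rightarrow> nat) r. strict_mono g \<and> (\<forall>p q. p \<noteq> q \<longrightarrow> h (g p) \<inter> h (g q) = r)"
proof (rule sunflower_subfamily[OF _ _ assms])
  fix T :: "nat \<Rightarrow> nat \<Rightarrow> bool"
  assume T: "\<And>F. finite F \<Longrightarrow> \<not> contains_copy {q. \<exists>p\<in>F. \<not> T p q}"
  have "\<exists>g :: nat \<Rightarrow> nat. \<forall>x. \<forall>y<x. g y < g x \<and> T (g y) (g x)"
  proof (rule dependent_wf_choice[OF wf_less_than, where P = "\<lambda>f x c. \<forall>y<x. f y < c \<and> T (f y) c"])
    fix x :: nat and f :: "nat \<Rightarrow> nat"
    let ?F = "f ` {..<x}"
    \<comment> \<open>At \<open>x = 0\<close> the set \<open>?F\<close> is empty and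
      \<open>Max ?F\<close> is an unspecified natural number; the excluded set is finite all the
      same.\<close>
    have "finite ({q. \<exists>p\<in>?F. \<not> T p q} \<union> {..Max ?F})"
      using T[of ?F] by (simp add: contains_copy_nat)
    then obtain c where c: "c \<notin> {q. \<exists>p\<in>?F. \<not> T p q} \<union> {..Max ?F}"
      using infinite_UNIV_nat ex_new_if_finite by blast
    have "f y < c \<and> T (f y) c" if "y < x" for y
      using c that Max_ge[of ?F "f y"] by fastforce
    then show "\<exists>c. \<forall>y<x. f y < c \<and> T (f y) c"
      by blast
  qed auto
  then obtain g :: "nat \<Rightarrow> nat" where "\<And>x y. y < x \<Longrightarrow> g y < g x \<and> T (g y) (g x)"
    by blast
  then show "\<exists>g :: nat \<Rightarrow> nat. strict_mono g \<and> (\<forall>p q. p < q \<longrightarrow> T (g p) (g q))"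
    by (intro exI[of _ g]) (simp add: strict_mono_def)
qed (simp add: contains_copy_nat)

section \<open>Indivisibility of the rationals and sunflowers over them\<close>

lemma finite_between:
  fixes L U :: "rat set"
  assumes "finite L" "finite U" "\<And>l u. l \<in> L \<Longrightarrow> u \<in> U \<Longrightarrow> l < u"
  shows "\<exists>c. (\<forall>l\<in>L. l < c) \<and> (\<forall>u\<in>U. c < u)"
proof (cases "L = {}")
  case True
  then show ?thesis
    using lt_ex[of "Min U"] Min_le[OF assms(2)] by (metis empty_iff order_less_le_trans)
next
  case L: False
  show ?thesis
  proof (cases "U = {}")
    case True
    then show ?thesis
      using gt_ex[of "Max L"] Max_ge[OF assms(1)] by (metis empty_iff order_le_less_trans)
  next
    case False
    then have "Max L < Min U"
      using L assms by simp
    then obtain c where "Max L < c" "c < Min U"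
      using dense by blast
    then show ?thesis
      using L False assms(1,2) by auto
  qed
qed

text \<open>Finite sets of points inside the cut can be enlarged by \<open>L\<close> and
  \<open>U\<close> before \<open>finite_between\<close> is applied, so the greedy construction never
  leaves the cut. Empty \<open>L\<close> or \<open>U\<close> gives rays and the whole line.\<close>

lemma rat_copy_in_cut:
  fixes L U :: "rat set"
  assumes "finite L" "finite U" "\<And>l u. l \<in> L \<Longrightarrow> u \<in> U \<Longrightarrow> l < u"
  shows "contains_copy {c. (\<forall>l\<in>L. l < c) \<and> (\<forall>u\<in>U. c < u)}" (is "contains_copy ?C")
proof -
  obtain g :: "rat \<Rightarrow> rat" where g: "range g \<subseteq> ?C" "\<And>x y. x < y \<Longrightarrow> g x < g y"
  proof (rule greedy_embedding_rat[of ?C "(<)"])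
    fix L' U' :: "rat set"
    assume "finite L'" "finite U'" "L' \<union> U' \<subseteq> ?C" "\<And>l u. l \<in> L' \<Longrightarrow> u \<in> U' \<Longrightarrow> l < u"
    then have "\<exists>c. (\<forall>l\<in>L \<union> L'. l < c) \<and> (\<forall>u\<in>U \<union> U'. c < u)"
      using assms by (intro finite_between) auto
    then show "\<exists>c\<in>?C. (\<forall>l\<in>L'. l < c) \<and> (\<forall>u\<in>U'. c < u)"
      by blast
  qed (rule that)
  then show ?thesis
    unfolding contains_copy_def strict_mono_def by (intro exI[of _ g] conjI allI impI)
qed

lemma contains_copy_image:
  fixes g :: "'q::linorder \<Rightarrow> 'q"
  assumes "strict_mono g" "contains_copy {q. g q \<in> A}"
  shows "contains_copy A"
proof -
  obtain f :: "'q \<Rightarrow> 'q" where f: "strict_mono f" "range f \<subseteq> {q. g q \<in> A}"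
    using assms(2) unfolding contains_copy_def by blast
  have "strict_mono (g \<circ> f)"
    using assms(1) f(1) by (simp add: strict_mono_def)
  moreover have "range (g \<circ> f) \<subseteq> A"
    using f(2) by auto
  ultimately show ?thesis
    unfolding contains_copy_def by blast
qed

text \<open>Inside the given copy, either \<open>A\<close> misses an open interval, which then lies
  in \<open>B\<close> and contains a copy, or \<open>A\<close> meets every open interval and the
  rationals embed into it greedily.\<close>

lemma indivisible_rat:
  fixes A B :: "rat set"
  assumes "contains_copy (A \<union> B)"
  shows "contains_copy A \<or> contains_copy B"
proof -
  obtain g :: "rat \<Rightarrow> rat" where g: "strict_mono g" "range g \<subseteq> A \<union> B"
    using assms unfolding contains_copy_def by blast
  let ?A = "{q. g q \<in> A}"
  show ?thesis
  proof (cases "\<exists>L U. finite L \<and> finite U \<and> (\<forall>l\<in>L. \<forall>u\<in>U. l < u) \<and>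
      {c. (\<forall>l\<in>L. l < c) \<and> (\<forall>u\<in>U. c < u)} \<inter> ?A = {}")
    case True
    then obtain L U where LU: "finite L" "finite U" "\<forall>l\<in>L. \<forall>u\<in>U. l < u"
      and "{c. (\<forall>l\<in>L. l < c) \<and> (\<forall>u\<in>U. c < u)} \<inter> ?A = {}" by blast
    then have "{c. (\<forall>l\<in>L. l < c) \<and> (\<forall>u\<in>U. c < u)} \<subseteq> {q. g q \<in> B}"
      using g(2) by blast
    then have "contains_copy {q. g q \<in> B}"
      using rat_copy_in_cut[of L U] LU unfolding contains_copy_def by (meson subset_trans)
    then show ?thesis
      using contains_copy_image[OF g(1)] by blast
  next
    case False
    obtain f :: "rat \<Rightarrow> rat" where "range f \<subseteq> ?A" "\<And>x y. x < y \<Longrightarrow> f x < f y"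
    proof (rule greedy_embedding_rat[of ?A "(<)"])
      fix L U :: "rat set"
      assume "finite L" "finite U" "\<And>l u. l \<in> L \<Longrightarrow> u \<in> U \<Longrightarrow> l < u"
      then have "{c. (\<forall>l\<in>L. l < c) \<and> (\<forall>u\<in>U. c < u)} \<inter> ?A \<noteq> {}"
        using False by meson
      then show "\<exists>c\<in>?A. (\<forall>l\<in>L. l < c) \<and> (\<forall>u\<in>U. c < u)"
        by blast
    qed (rule that)
    then have "contains_copy ?A"
      unfolding contains_copy_def strict_mono_def by (intro exI[of _ f] conjI allI impI)
    then show ?thesis
      using contains_copy_image[OF g(1)] by blast
  qed
qed

lemma sunflower_subfamily_rat:
  fixes h :: "rat \<Rightarrow> 'b set"
  assumes "\<And>q. finite (h q) \<and> card (h q) = n"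
  shows "\<exists>(g :: rat \<Rightarrow> rat) r. strict_mono g \<and> (\<forall>p q. p \<noteq> q \<longrightarrow> h (g p) \<inter> h (g q) = r)"
proof (rule sunflower_subfamily[OF indivisible_rat _ assms])
  fix T :: "rat \<Rightarrow> rat \<Rightarrow> bool"
  assume "symp T" and T: "\<And>F. finite F \<Longrightarrow> \<not> contains_copy {q. \<exists>p\<in>F. \<not> T p q}"
  obtain g :: "rat \<Rightarrow> rat" where "\<And>x y. x < y \<Longrightarrow> g x < g y \<and> T (g x) (g y)"
  proof (rule greedy_embedding_rat[of UNIV "\<lambda>x y. x < y \<and> T x y"])
    fix L U :: "rat set"
    assume LU: "finite L" "finite U" "\<And>l u. l \<in> L \<Longrightarrow> u \<in> U \<Longrightarrow> l < u \<and> T l u"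
    have "contains_copy {c. (\<forall>l\<in>L. l < c) \<and> (\<forall>u\<in>U. c < u)}"
      using LU by (intro rat_copy_in_cut) auto
    \<comment> \<open>The cut contains a copy and the points in conflict with \<open>L\<close> or
      \<open>U\<close> do not, so some point of the cut conflicts with none of them.\<close>
    then have "\<not> {c. (\<forall>l\<in>L. l < c) \<and> (\<forall>u\<in>U. c < u)} \<subseteq> {q. \<exists>p\<in>L \<union> U. \<not> T p q}"
      using T[of "L \<union> U"] LU(1,2) unfolding contains_copy_def by (meson finite_UnI subset_trans)
    then show "\<exists>c\<in>UNIV. (\<forall>l\<in>L. l < c \<and> T l c) \<and> (\<forall>u\<in>U. c < u \<and> T c u)"
      using \<open>symp T\<close> unfolding symp_def by blast
  qed (rule that)
  then show "\<exists>g :: rat \<Rightarrow> rat. strict_mono g \<and> (\<forall>p q. p < q \<longrightarrow> T (g p) (g q))"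
    by (intro exI[of _ g]) (simp add: strict_mono_def)
qed

section \<open>The three kinds of orders are sunflowerable\<close>

lemma countable_embeds_rat:
  assumes "linear_order_on X le" "countable X"
  shows "embeds X le UNIV rat_le"
proof -
  have "\<exists>g. g ` X \<subseteq> (UNIV :: rat set) \<and> (\<forall>x\<in>X. \<forall>y\<in>X. (x, y) \<in> le \<and> x \<noteq> y \<longrightarrow> g x < g y)"
    using finite_between by (intro greedy_embedding[OF assms]) auto
  then obtain g :: "'a \<Rightarrow> rat" where g: "\<forall>x\<in>X. \<forall>y\<in>X. (x, y) \<in> le \<and> x \<noteq> y \<longrightarrow> g x < g y"
    by blast
  have "embedding X le UNIV rat_le g"
  proof (rule embeddingI_strict[OF assms(1) linear_rat])
    fix x y assume "x \<in> X" "y \<in> X" "(x, y) \<in> le" "x \<noteq> y"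
    then show "(g x, g y) \<in> rat_le \<and> g x \<noteq> g y"
      using g unfolding rat_le_strict by blast
  qed simp
  then show ?thesis
    unfolding embeds_def by blast
qed

text \<open>Only mutual embeddability matters: restrict the family along \<open>b\<close>, thin it
  out by \<open>g\<close>, and let \<open>a\<close> find \<open>X\<close> inside the result.\<close>

lemma sunflowerable_if_equimorphic:
  fixes s :: "'q rel" and X :: "'a set"
  assumes "embeds X le UNIV s" "embeds UNIV s X le"
    and sf: "\<And>(h :: 'q \<Rightarrow> 'b set) n. (\<And>q. finite (h q) \<and> card (h q) = n) \<Longrightarrow>
      \<exists>g r. embedding UNIV s UNIV s g \<and> (\<forall>p q. p \<noteq> q \<longrightarrow> h (g p) \<inter> h (g q) = r)"
  shows "sunflowerable TYPE('b) X le"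
  unfolding sunflowerable_def n_sunflowerable_iff
proof (intro allI impI)
  fix n and h :: "'a \<Rightarrow> 'b set"
  assume h: "inj_on h X \<and> (\<forall>x\<in>X. finite (h x) \<and> card (h x) = n)"
  obtain a b where a: "embedding X le UNIV s a" and b: "embedding UNIV s X le b"
    using assms(1,2) unfolding embeds_def by blast
  have "b q \<in> X" for q
    using b unfolding embedding_def by blast
  then have "finite (h (b q)) \<and> card (h (b q)) = n" for q
    using h by simp
  from sf[of "\<lambda>q. h (b q)", OF this] obtain g r where g: "embedding UNIV s UNIV s g"
    and r: "\<forall>p q. p \<noteq> q \<longrightarrow> h (b (g p)) \<inter> h (b (g q)) = r"
    by (elim exE conjE)
  have "embedding X le X le (b \<circ> g \<circ> a)"
    using embedding_compose[OF a embedding_compose[OF g b]] by (simp add: o_assoc)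
  moreover have "h ((b \<circ> g \<circ> a) x) \<inter> h ((b \<circ> g \<circ> a) y) = r" if "x \<in> X" "y \<in> X" "x \<noteq> y" for x y
    using r a that unfolding embedding_def inj_on_def by auto
  ultimately show "\<exists>g r. embedding X le X le g \<and> (\<forall>x\<in>X. \<forall>y\<in>X. x \<noteq> y \<longrightarrow> h (g x) \<inter> h (g y) = r)"
    by (intro exI[of _ "b \<circ> g \<circ> a"] exI[of _ r] conjI ballI impI)
qed

lemma sunflowerable_cases:
  assumes "linear_order_on X le" "countable X"
    and "isomorphic X le (UNIV :: nat set) omega_le \<or>
       isomorphic X le (UNIV :: nat set) (omega_le\<inverse>) \<or>
       embeds (UNIV :: rat set) rat_le X le"
  shows "sunflowerable TYPE('b) X le"
proof -
  have omega: "\<exists>g r. embedding UNIV omega_le UNIV omega_le g \<and> (\<forall>p q. p \<noteq> q \<longrightarrow> h (g p) \<inter> h (g q) = r)"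
    if h: "\<And>q. finite (h q) \<and> card (h q) = n" for h :: "nat \<Rightarrow> 'b set" and n
  proof -
    obtain g :: "nat \<Rightarrow> nat" and r
      where g: "strict_mono g" "\<forall>p q. p \<noteq> q \<longrightarrow> h (g p) \<inter> h (g q) = r"
      using sunflower_subfamily_nat[of h, OF h] by (elim exE conjE)
    have "embedding UNIV omega_le UNIV omega_le g"
      using g(1) unfolding embedding_def omega_le_def
      by (simp add: strict_mono_less_eq strict_mono_imp_inj_on)
    with g(2) show ?thesis
      by (intro exI[of _ g] exI[of _ r] conjI)
  qed
  have rat: "\<exists>g r. embedding UNIV rat_le UNIV rat_le g \<and> (\<forall>p q. p \<noteq> q \<longrightarrow> h (g p) \<inter> h (g q) = r)"
    if h: "\<And>q. finite (h q) \<and> card (h q) = n" for h :: "rat \<Rightarrow> 'b set" and n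
  proof -
    obtain g :: "rat \<Rightarrow> rat" and r
      where g: "strict_mono g" "\<forall>p q. p \<noteq> q \<longrightarrow> h (g p) \<inter> h (g q) = r"
      using sunflower_subfamily_rat[of h, OF h] by (elim exE conjE)
    have "embedding UNIV rat_le UNIV rat_le g"
      using g(1) unfolding embedding_def rat_le_def
      by (simp add: strict_mono_less_eq strict_mono_imp_inj_on)
    with g(2) show ?thesis
      by (intro exI[of _ g] exI[of _ r] conjI)
  qed
  consider "isomorphic X le UNIV omega_le" | "isomorphic X le UNIV (omega_le\<inverse>)"
    | "embeds UNIV rat_le X le"
    using assms(3) by blast
  then show ?thesis
  proof cases
    case 1
    show ?thesis
      by (rule sunflowerable_if_equimorphic[OF isomorphic_embeds[OF 1]
            isomorphic_embeds[OF isomorphic_sym[OF 1]] omega])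
  next
    case 2
    \<comment> \<open>Reversing the order changes neither the self-embeddings nor the condition on
      intersections.\<close>
    have "\<exists>g r. embedding UNIV (omega_le\<inverse>) UNIV (omega_le\<inverse>) g \<and> (\<forall>p q. p \<noteq> q \<longrightarrow> h (g p) \<inter> h (g q) = r)"
      if "\<And>q. finite (h q) \<and> card (h q) = n" for h :: "nat \<Rightarrow> 'b set" and n
      unfolding embedding_converse using that by (rule omega)
    then show ?thesis
      by (rule sunflowerable_if_equimorphic[OF isomorphic_embeds[OF 2]
            isomorphic_embeds[OF isomorphic_sym[OF 2]]])
  next
    case 3
    \<comment> \<open>A countable order containing the rationals also embeds into them, so the two
      are mutually embeddable.\<close>
    show ?thesis
      by (rule sunflowerable_if_equimorphic[OF countable_embeds_rat[OF assms(1,2)] 3 rat])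
  qed
qed

section \<open>Consequences of 2-sunflowerability for colourings\<close>

text \<open>The family witnessing this is a graph that is a disjoint union of stars, one star for each
  value of \<open>k\<close>: an infinite sunflower of its edges is contained in a single star or is a matching.\<close>
lemma canonical_if_2_sunflowerable:
  fixes X :: "'a set" and k :: "'a \<Rightarrow> 'c"
  assumes sf: "n_sunflowerable TYPE('b) 2 X le" and cnt: "countable X"
    and inf: "infinite X" "infinite (UNIV :: 'b set)"
  shows "\<exists>g. embedding X le X le g \<and> (inj_on (k \<circ> g) X \<or> (\<forall>x\<in>X. \<forall>y\<in>X. k (g x) = k (g y)))"
proof -
  obtain \<iota> :: "nat \<Rightarrow> 'b" where \<iota>: "inj \<iota>"
    using infinite_countable_subset[OF inf(2)] by blast
  define m where "m = to_nat_on X"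
  have m: "m x = m y \<longleftrightarrow> x = y" if "x \<in> X" "y \<in> X" for x y
    unfolding m_def using cnt that by simp
  define c where "c x = to_nat_on (k ` X) (k x)" for x
  have c: "c x = c y \<longleftrightarrow> k x = k y" if "x \<in> X" "y \<in> X" for x y
    unfolding c_def using cnt that by simp
  \<comment> \<open>The edge of \<open>x\<close> joins the centre of its star, coded by the even
    number \<open>2 * c x\<close>, to a leaf of its own, coded by an odd number; parity keeps
    centres and leaves apart.\<close>
  define h where "h x = {\<iota> (2 * c x), \<iota> (2 * m x + 1)}" for x
  have \<iota>_eq: "\<iota> i = \<iota> j \<longleftrightarrow> i = j" for i j
    using \<iota> by (simp add: inj_eq)
  have parity: "2 * i \<noteq> Suc (2 * j)" "Suc (2 * j) \<noteq> 2 * i" for i j :: nat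
    by presburger+
  have meet: "h x \<inter> h y = (if k x = k y then {\<iota> (2 * c x)} else {})"
    if "x \<in> X" "y \<in> X" "x \<noteq> y" for x y
    using that m[of x y] c[of x y] unfolding h_def by (auto simp: \<iota>_eq parity)
  have h2: "finite (h x) \<and> card (h x) = 2" for x
    unfolding h_def by (simp add: \<iota>_eq parity)
  have "inj_on h X"
  proof (rule inj_onI, rule ccontr)
    fix x y assume "x \<in> X" "y \<in> X" "h x = h y" "x \<noteq> y"
    then have "card (h x) \<le> 1"
      using meet[of x y] by (auto split: if_splits)
    then show False
      using h2[of x] by simp
  qed
  then have "\<exists>g r. embedding X le X le g \<and> (\<forall>x\<in>X. \<forall>y\<in>X. x \<noteq> y \<longrightarrow> h (g x) \<inter> h (g y) = r)"
    using sf[unfolded n_sunflowerable_iff, rule_format, of h] h2 by simp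
  then obtain g r where g: "embedding X le X le g"
    and r: "\<forall>x\<in>X. \<forall>y\<in>X. x \<noteq> y \<longrightarrow> h (g x) \<inter> h (g y) = r"
    by (elim exE conjE)
  have gX: "g x \<in> X" if "x \<in> X" for x
    using g that unfolding embedding_def by blast
  have gmeet: "r = (if k (g x) = k (g y) then {\<iota> (2 * c (g x))} else {})"
    if "x \<in> X" "y \<in> X" "x \<noteq> y" for x y
  proof -
    have "g x \<noteq> g y"
      using g that unfolding embedding_def inj_on_def by metis
    then show ?thesis
      using r that meet[of "g x" "g y"] gX by simp
  qed
  have "inj_on (k \<circ> g) X \<or> (\<forall>x\<in>X. \<forall>y\<in>X. k (g x) = k (g y))"
  proof (cases "r = {}")
    case True
    then have "inj_on (k \<circ> g) X"
      using gmeet by (metis comp_apply inj_onI insert_not_empty)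
    then show ?thesis ..
  next
    case False
    then show ?thesis
      using gmeet by metis
  qed
  with g show ?thesis
    by blast
qed

text \<open>Colour a point by the least index, in an enumeration of \<open>X\<close>, of a point above it. Each colour
  class is bounded, so the colouring is injective, and hence increasing, on a copy of \<open>X\<close>.\<close>
lemma isomorphic_omega_if_short_initial_segments:
  fixes X :: "'a set"
  assumes lin: "linear_order_on X le" and cnt: "countable X" and inf: "infinite X"
    and canonical: "\<And>k :: 'a \<Rightarrow> nat. \<exists>g. embedding X le X le g \<and>
      (inj_on (k \<circ> g) X \<or> (\<forall>x\<in>X. \<forall>y\<in>X. k (g x) = k (g y)))"
    and short: "\<And>y. y \<in> X \<Longrightarrow> \<not> embeds X le {x \<in> X. (x, y) \<in> le} le"
  shows "isomorphic X le UNIV omega_le"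
proof -
  have refl: "(x, x) \<in> le" if "x \<in> X" for x
    using lin that unfolding linear_order_on_def partial_order_on_def preorder_on_def refl_on_def by blast
  have "trans le"
    using lin unfolding linear_order_on_def partial_order_on_def preorder_on_def by blast
  define e where "e = from_nat_into X"
  define k where "k x = (LEAST i. (x, e i) \<in> le)" for x
  have eX: "e i \<in> X" for i
    unfolding e_def using inf by (intro from_nat_into) auto
  have k: "(x, e (k x)) \<in> le" if x: "x \<in> X" for x
  proof -
    obtain i where "e i = x"
      unfolding e_def using x cnt from_nat_into_surj by metis
    then show ?thesis
      unfolding k_def using refl[OF x] by (metis (mono_tags, lifting) LeastI)
  qed
  have kmono: "k x \<le> k y" if "x \<in> X" "y \<in> X" "(x, y) \<in> le" for x y
  proof -
    have "(x, e (k y)) \<in> le"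
      using k[of y] that \<open>trans le\<close> unfolding trans_def by blast
    then show ?thesis
      unfolding k_def[of x] by (rule Least_le)
  qed
  obtain g where g: "embedding X le X le g"
    and cases: "inj_on (k \<circ> g) X \<or> (\<forall>x\<in>X. \<forall>y\<in>X. k (g x) = k (g y))"
    using canonical[of k] by blast
  have gX: "g x \<in> X" if "x \<in> X" for x
    using g that unfolding embedding_def by blast
  have "inj_on (k \<circ> g) X"
  proof (rule ccontr)
    \<comment> \<open>The colouring would be constant on the copy, and one point
      \<open>e (k (g a))\<close> would bound the whole copy.\<close>
    assume "\<not> inj_on (k \<circ> g) X"
    then obtain a where "a \<in> X" and const: "\<And>x. x \<in> X \<Longrightarrow> k (g x) = k (g a)"
      using cases inf unfolding inj_on_def by blast
    have "g ` X \<subseteq> {x \<in> X. (x, e (k (g a))) \<in> le}"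
      using k gX const by (metis (mono_tags, lifting) image_subsetI mem_Collect_eq)
    then have "embeds X le {x \<in> X. (x, e (k (g a))) \<in> le} le"
      using embedding_subset[OF g] unfolding embeds_def by blast
    then show False
      using short eX by blast
  qed
  then have "embedding X le UNIV omega_le (k \<circ> g)"
    using gX kmono g embedding_strict[OF g]
    by (intro embeddingI_strict[OF lin linear_omega]) (auto simp: omega_le_def inj_on_def)
  then show ?thesis
    using inf by (rule isomorphic_omega_if_embeds)
qed

text \<open>Needed for \<open>T x y\<close> meaning that \<open>X\<close> embeds into \<open>[x, y]\<close>. A total order on finitely many
  points does not force \<open>T\<close> between them, so the greedy construction is run with \<open>T\<close> itself.\<close>
lemma rat_embeds_if_dense_relation:
  assumes lin: "linear_order_on X le"
    and T: "\<And>x y. T x y \<Longrightarrow> x \<in> X \<and> y \<in> X \<and> (x, y) \<in> le \<and> x \<noteq> y"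
    and wider: "\<And>w x y z. T x y \<Longrightarrow> (w, x) \<in> le \<Longrightarrow> (y, z) \<in> le \<Longrightarrow> T w z"
    and dense: "\<And>x y. T x y \<Longrightarrow> \<exists>z. T x z \<and> T z y"
    and ab: "T a b"
  shows "embeds UNIV rat_le X le"
proof -
  have refl: "(x, x) \<in> le" if "x \<in> X" for x
    using lin that unfolding linear_order_on_def partial_order_on_def preorder_on_def refl_on_def by blast
  \<comment> \<open>\<open>T\<close> is transitive by \<open>wider\<close>, since it implies
    \<open>le\<close>; hence a finite set whose points are pairwise related by \<open>T\<close> has
    extreme elements with respect to \<open>T\<close>.\<close>
  have top: "\<exists>z\<in>L. \<forall>x\<in>L. x = z \<or> T x z"
    if "finite L" "L \<noteq> {}" "\<And>x y. x \<in> L \<Longrightarrow> y \<in> L \<Longrightarrow> x \<noteq> y \<Longrightarrow> T x y \<or> T y x" for L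
    using that
  proof (induction L rule: finite_ne_induct)
    case (insert x F)
    then obtain z where z: "z \<in> F" "\<forall>x\<in>F. x = z \<or> T x z"
      by auto
    have "T x z \<or> T z x"
      using insert.prems insert.hyps z(1) by (metis insertCI)
    then show ?case
      using z T wider refl by (metis insert_iff)
  qed simp
  have bot: "\<exists>z\<in>L. \<forall>x\<in>L. x = z \<or> T z x"
    if "finite L" "L \<noteq> {}" "\<And>x y. x \<in> L \<Longrightarrow> y \<in> L \<Longrightarrow> x \<noteq> y \<Longrightarrow> T x y \<or> T y x" for L
    using that
  proof (induction L rule: finite_ne_induct)
    case (insert x F)
    then obtain z where z: "z \<in> F" "\<forall>x\<in>F. x = z \<or> T z x"
      by auto
    have "T x z \<or> T z x"
      using insert.prems insert.hyps z(1) by (metis insertCI)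
    then show ?case
      using z T wider refl by (metis insert_iff)
  qed simp
  \<comment> \<open>Working between \<open>a\<close> and \<open>b\<close> allows them to be added to
    \<open>L\<close> and \<open>U\<close>, which makes both sets nonempty and provides the extreme
    points \<open>p\<close> and \<open>q\<close>.\<close>
  let ?B = "{c. T a c \<and> T c b}"
  obtain g :: "rat \<Rightarrow> 'a" where g: "range g \<subseteq> ?B" "\<And>x y. x < y \<Longrightarrow> T (g x) (g y)"
  proof (rule greedy_embedding_rat[of ?B T])
    fix L U
    assume LU: "finite L" "finite U" "L \<union> U \<subseteq> ?B" "\<And>l u. l \<in> L \<Longrightarrow> u \<in> U \<Longrightarrow> T l u"
      and chain: "\<And>x y. x \<in> L \<union> U \<Longrightarrow> y \<in> L \<union> U \<Longrightarrow> x \<noteq> y \<Longrightarrow> T x y \<or> T y x"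
    have "\<exists>z\<in>insert a L. \<forall>x\<in>insert a L. x = z \<or> T x z"
      using LU chain by (intro top) blast+
    then obtain p where p: "p \<in> insert a L" "\<forall>x\<in>insert a L. x = p \<or> T x p"
      by blast
    have "\<exists>z\<in>insert b U. \<forall>x\<in>insert b U. x = z \<or> T z x"
      using LU chain by (intro bot) blast+
    then obtain q where q: "q \<in> insert b U" "\<forall>x\<in>insert b U. x = q \<or> T q x"
      by blast
    have "T p q"
      using p(1) q(1) LU ab by blast
    then obtain c where c: "T p c" "T c q"
      using dense by blast
    have "T x c" if "x \<in> insert a L" for x
      using p(2) that c(1) T wider refl by metis
    moreover have "T c x" if "x \<in> insert b U" for x
      using q(2) that c(2) T wider refl by metis
    ultimately show "\<exists>c\<in>?B. (\<forall>l\<in>L. T l c) \<and> (\<forall>u\<in>U. T c u)"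
      by blast
  qed (rule that)
  then have "embedding UNIV rat_le X le g"
    using T rat_le_strict by (intro embeddingI_strict[OF linear_rat lin]) blast+
  then show ?thesis
    unfolding embeds_def by blast
qed

section \<open>Orders without a copy of the rationals\<close>

text \<open>The canonicity hypothesis appears for two colour types because a hypothesis is not
  polymorphic: naturals serve for indivisibility and for the colouring along a cofinal sequence,
  sets for the colouring by equivalence classes.\<close>

lemma cases_if_canonical:
  fixes X :: "'a set"
  assumes lin: "linear_order_on X le" and cnt: "countable X" and inf: "infinite X"
    and canon_nat: "\<And>k :: 'a \<Rightarrow> nat. \<exists>g. embedding X le X le g \<and>
      (inj_on (k \<circ> g) X \<or> (\<forall>x\<in>X. \<forall>y\<in>X. k (g x) = k (g y)))"
    and canon_set: "\<And>k :: 'a \<Rightarrow> 'a set. \<exists>g. embedding X le X le g \<and>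
      (inj_on (k \<circ> g) X \<or> (\<forall>x\<in>X. \<forall>y\<in>X. k (g x) = k (g y)))"
    and scattered: "\<not> embeds UNIV rat_le X le"
  shows "isomorphic X le UNIV omega_le \<or> isomorphic X le UNIV (omega_le\<inverse>)"
proof -
  have refl: "(x, x) \<in> le" if "x \<in> X" for x
    using lin that unfolding linear_order_on_def partial_order_on_def preorder_on_def refl_on_def by blast
  have trans: "(x, z) \<in> le" if "(x, y) \<in> le" "(y, z) \<in> le" for x y z
    using lin that unfolding linear_order_on_def partial_order_on_def preorder_on_def trans_def by blast
  have anti: "x = y" if "(x, y) \<in> le" "(y, x) \<in> le" for x y
    using lin that unfolding linear_order_on_def partial_order_on_def antisym_def by blast
  have tot: "(x, y) \<in> le \<or> (y, x) \<in> le" if "x \<in> X" "y \<in> X" for x y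
    using lin that refl unfolding linear_order_on_def total_on_def by metis
  have lein: "x \<in> X" "y \<in> X" if "(x, y) \<in> le" for x y
    using lin that unfolding linear_order_on_def partial_order_on_def preorder_on_def by blast+
  define I where "I x y = {z \<in> X. (x, z) \<in> le \<and> (z, y) \<in> le}" for x y
  define big where "big S \<longleftrightarrow> embeds X le S le" for S
  have big_mono: "big S'" if "big S" "S \<subseteq> S'" for S S'
    using that embeds_mono unfolding big_def by blast
  have big_image: "big (g ` S)" if g: "embedding X le X le g" and S: "big S" "S \<subseteq> X" for g S
  proof -
    obtain f where f: "embedding X le S le f"
      using S(1) unfolding big_def embeds_def by blast
    have "embedding S le (g ` S) le g"
      using g S(2) unfolding embedding_def by (auto intro: inj_on_subset)
    with f show ?thesis
      unfolding big_def embeds_def using embedding_compose by blast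
  qed
  have big_transfer: "big (I (g x) (g y))"
    if "embedding X le X le g" "big (I x y)" "x \<in> X" "y \<in> X" for g x y
  proof (rule big_mono)
    show "big (g ` I x y)"
      using that(1,2) by (rule big_image) (auto simp: I_def)
    show "g ` I x y \<subseteq> I (g x) (g y)"
      using that(1,3,4) by (auto simp: I_def embedding_def)
  qed
  \<comment> \<open>A colouring with two values cannot be injective on an infinite copy, so it is
    constant there.\<close>
  have indivisible: "big A \<or> big B" if "big (A \<union> B)" "A \<union> B \<subseteq> X" for A B
  proof -
    obtain f where f: "embedding X le (A \<union> B) le f"
      using \<open>big (A \<union> B)\<close> unfolding big_def embeds_def by blast
    obtain g where g: "embedding X le X le g" and
      cases: "inj_on ((\<lambda>x. of_bool (f x \<in> A) :: nat) \<circ> g) X \<or>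
        (\<forall>x\<in>X. \<forall>y\<in>X. (of_bool (f (g x) \<in> A) :: nat) = of_bool (f (g y) \<in> A))"
      using canon_nat[of "\<lambda>x. of_bool (f x \<in> A)"] by blast
    have "\<not> inj_on ((\<lambda>x. of_bool (f x \<in> A) :: nat) \<circ> g) X"
    proof
      assume "inj_on ((\<lambda>x. of_bool (f x \<in> A) :: nat) \<circ> g) X"
      then have "infinite (((\<lambda>x. of_bool (f x \<in> A) :: nat) \<circ> g) ` X)"
        using inf finite_imageD by blast
      moreover have "((\<lambda>x. of_bool (f x \<in> A) :: nat) \<circ> g) ` X \<subseteq> {0, 1}"
        by auto
      ultimately show False
        using finite_subset by blast
    qed
    then have "(\<forall>x\<in>X. f (g x) \<in> A) \<or> (\<forall>x\<in>X. f (g x) \<notin> A)"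
      using cases by (metis of_bool_eq_iff)
    moreover have fg: "embedding X le (A \<union> B) le (f \<circ> g)"
      using g f by (rule embedding_compose)
    ultimately have "(f \<circ> g) ` X \<subseteq> A \<or> (f \<circ> g) ` X \<subseteq> B"
      unfolding embedding_def by auto
    then show ?thesis
      using embedding_subset[OF fg] unfolding big_def embeds_def by blast
  qed
  have "big X"
    unfolding big_def embeds_def embedding_def by (intro exI[of _ id]) auto
  have bounded: "\<not> big (I x y)" for x y
  proof
    assume xy: "big (I x y)"
    \<comment> \<open>Indivisibility makes \<open>sim\<close> transitive. If \<open>X\<close> embeds into a transversal of \<open>sim\<close>, then it
      contains the rationals; if it embeds into a single class, then \<open>[x, y]\<close> cannot contain a copy.\<close>
    define sim where "sim x y \<longleftrightarrow> \<not> big (I x y) \<and> \<not> big (I y x)" for x y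
    have sim_le: "sim x y \<longleftrightarrow> \<not> big (I x y)" if "(x, y) \<in> le" for x y
    proof -
      have "I y x \<subseteq> I x y"
        unfolding I_def using that trans by blast
      then show ?thesis
        unfolding sim_def using big_mono by blast
    qed
    have sim_trans: "sim x z" if "x \<in> X" "y \<in> X" "z \<in> X" "sim x y" "sim y z" for x y z
    proof -
      have *: "\<not> big (I a c)" if "b \<in> X" "\<not> big (I a b)" "\<not> big (I b c)" for a b c
      proof
        assume "big (I a c)"
        moreover have "I a c \<subseteq> I a b \<union> I b c"
          unfolding I_def using tot[OF _ that(1)] by blast
        ultimately have "big (I a b \<union> I b c)"
          by (rule big_mono)
        then show False
          using indivisible[of "I a b" "I b c"] that unfolding I_def by blast
      qed
      show ?thesis
        using *[of y x z] *[of y z x] that unfolding sim_def by blast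
    qed
    have sim_sym: "sim x y \<longleftrightarrow> sim y x" for x y
      unfolding sim_def by blast
    define k where "k x = {y \<in> X. sim x y}" for x
    obtain g where g: "embedding X le X le g"
      and cases: "inj_on (k \<circ> g) X \<or> (\<forall>x\<in>X. \<forall>y\<in>X. k (g x) = k (g y))"
      using canon_set[of k] by blast
    have gX: "g x \<in> X" if "x \<in> X" for x
      using g that unfolding embedding_def by blast
    have k_eq: "k x = k y" if "x \<in> X" "y \<in> X" "sim x y" for x y
      unfolding k_def using that sim_trans sim_sym by blast
    show False
    proof (cases "inj_on (k \<circ> g) X")
      case True
      have split: "big (I (g a) (g b))" if "a \<in> X" "b \<in> X" "(a, b) \<in> le" "a \<noteq> b" for a b
      proof (rule ccontr)
        assume "\<not> big (I (g a) (g b))"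
        then have "sim (g a) (g b)"
          using g that sim_le unfolding embedding_def by blast
        then have "k (g a) = k (g b)"
          using k_eq gX that by blast
        then show False
          using True that unfolding inj_on_def by auto
      qed
      \<comment> \<open>Three points of the transversal, moved into \<open>[x, y]\<close> by an
        embedding of \<open>X\<close>, have a middle point with a copy of \<open>X\<close> on either
        side. This is the density of \<open>T\<close>.\<close>
      have "\<exists>a\<in>X. \<exists>b\<in>X. \<exists>c\<in>X. (a, b) \<in> le \<and> a \<noteq> b \<and> (b, c) \<in> le \<and> b \<noteq> c"
      proof -
        obtain S where S: "S \<subseteq> X" "card S = 3" "finite S"
          using infinite_arbitrarily_large[OF inf] by metis
        then obtain u v w where "u \<in> X" "v \<in> X" "w \<in> X" "u \<noteq> v" "u \<noteq> w" "v \<noteq> w"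
          by (auto simp: card_3_iff)
        then show ?thesis
          using tot by metis
      qed
      then obtain a b c where abc: "a \<in> X" "b \<in> X" "c \<in> X" "(a, b) \<in> le" "a \<noteq> b" "(b, c) \<in> le" "b \<noteq> c"
        by blast
      define T where "T x y \<longleftrightarrow> x \<in> X \<and> y \<in> X \<and> (x, y) \<in> le \<and> x \<noteq> y \<and> big (I x y)" for x y
      have dense: "\<exists>z. T x z \<and> T z y" if xy: "T x y" for x y
      proof -
        obtain f where f: "embedding X le (I x y) le f"
          using xy unfolding T_def big_def embeds_def by blast
        then have fX: "embedding X le X le f"
          by (rule embedding_subset) (use f in \<open>auto simp: embedding_def I_def\<close>)
        let ?u = "f (g a)" and ?v = "f (g b)" and ?w = "f (g c)"
        have in_I: "?u \<in> I x y" "?v \<in> I x y" "?w \<in> I x y"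
          using f gX abc unfolding embedding_def by blast+
        have fg: "embedding X le X le (f \<circ> g)"
          using g fX by (rule embedding_compose)
        have uvw: "(?u, ?v) \<in> le" "?u \<noteq> ?v" "(?v, ?w) \<in> le" "?v \<noteq> ?w"
          using embedding_strict[OF fg] abc by auto
        have "big (I ?u ?v)" "big (I ?v ?w)"
          using big_transfer[OF fX] split abc gX by auto
        moreover have "I ?u ?v \<subseteq> I x ?v" "I ?v ?w \<subseteq> I ?v y"
          using in_I trans unfolding I_def by blast+
        ultimately have "big (I x ?v)" "big (I ?v y)"
          using big_mono by blast+
        moreover have "x \<noteq> ?v" "?v \<noteq> y"
          using in_I uvw anti unfolding I_def by blast+
        ultimately have "T x ?v \<and> T ?v y"
          using in_I xy unfolding T_def I_def by blast
        then show ?thesis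
          by blast
      qed
      have Tab: "T (g a) (g b)"
        unfolding T_def using split abc gX embedding_strict[OF g] by blast
      have wider: "T w z" if "T x y" "(w, x) \<in> le" "(y, z) \<in> le" for w x y z
      proof -
        have "I x y \<subseteq> I w z"
          unfolding I_def using that trans by blast
        then show ?thesis
          using that big_mono lein trans anti unfolding T_def by metis
      qed
      have "embeds UNIV rat_le X le"
        by (rule rat_embeds_if_dense_relation[OF lin _ wider dense Tab]) (simp add: T_def)
      with scattered show False
        by blast
    next
      case False
      then have const: "k (g x) = k (g y)" if "x \<in> X" "y \<in> X" for x y
        using cases that by blast
      obtain z where "z \<in> I x y"
        using xy inf unfolding big_def embeds_def embedding_def by fastforce
      then have "(x, y) \<in> le"
        unfolding I_def using trans by blast
      then have "x \<in> X" "y \<in> X"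
        by (rule lein)+
      then have "k (g x) = k (g y)"
        by (rule const)
      have "(g x, g y) \<in> le"
        using g \<open>x \<in> X\<close> \<open>y \<in> X\<close> \<open>(x, y) \<in> le\<close> unfolding embedding_def by blast
      then have not_sim: "\<not> sim (g x) (g y)"
        using sim_le big_transfer[OF g xy \<open>x \<in> X\<close> \<open>y \<in> X\<close>] by simp
      \<comment> \<open>One-point intervals contain no copy of the infinite \<open>X\<close>, so
        \<open>sim\<close> is reflexive at \<open>g y\<close> and this point belongs to its own
        class.\<close>
      have "I (g y) (g y) \<subseteq> {g y}"
        unfolding I_def using anti by blast
      then have "\<not> big (I (g y) (g y))"
        using inf finite_subset unfolding big_def embeds_def embedding_def
        by (metis finite.emptyI finite.insertI finite_imageD)
      then have "g y \<in> k (g y)"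
        unfolding k_def sim_def using gX \<open>y \<in> X\<close> by blast
      then have "sim (g x) (g y)"
        using \<open>k (g x) = k (g y)\<close> unfolding k_def by blast
      with not_sim show False ..
    qed
  qed
  obtain x0 where "x0 \<in> X"
    using inf by fastforce
  have "X = {x \<in> X. (x, x0) \<in> le} \<union> {x \<in> X. (x0, x) \<in> le}"
    using tot \<open>x0 \<in> X\<close> by blast
  then have "big {x \<in> X. (x, x0) \<in> le} \<or> big {x \<in> X. (x0, x) \<in> le}"
    using indivisible[of "{x \<in> X. (x, x0) \<in> le}" "{x \<in> X. (x0, x) \<in> le}"] \<open>big X\<close> by simp
  then show ?thesis
  proof
    assume "big {x \<in> X. (x0, x) \<in> le}"
    then obtain e where e: "embedding X le {x \<in> X. (x0, x) \<in> le} le e"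
      unfolding big_def embeds_def by blast
    then have eX: "embedding X le X le e"
      by (rule embedding_subset) (use e in \<open>auto simp: embedding_def\<close>)
    \<comment> \<open>As \<open>e\<close> moves \<open>X\<close> above \<open>x0\<close>, it takes
      the initial segment below \<open>y\<close> into the bounded interval from \<open>x0\<close> to
      \<open>e y\<close>.\<close>
    have "\<not> embeds X le {x \<in> X. (x, y) \<in> le} le" if "y \<in> X" for y
    proof
      assume "embeds X le {x \<in> X. (x, y) \<in> le} le"
      then have "big (e ` {x \<in> X. (x, y) \<in> le})"
        by (intro big_image[OF eX]) (auto simp: big_def)
      moreover have "e ` {x \<in> X. (x, y) \<in> le} \<subseteq> I x0 (e y)"
        using e that unfolding I_def embedding_def by auto
      ultimately show False
        using bounded big_mono by blast
    qed
    then show ?thesis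
      using isomorphic_omega_if_short_initial_segments[OF lin cnt inf canon_nat] by blast
  next
    assume "big {x \<in> X. (x, x0) \<in> le}"
    then obtain e where e: "embedding X le {x \<in> X. (x, x0) \<in> le} le e"
      unfolding big_def embeds_def by blast
    then have eX: "embedding X le X le e"
      by (rule embedding_subset) (use e in \<open>auto simp: embedding_def\<close>)
    have "\<not> embeds X le {x \<in> X. (y, x) \<in> le} le" if "y \<in> X" for y
    proof
      assume "embeds X le {x \<in> X. (y, x) \<in> le} le"
      then have "big (e ` {x \<in> X. (y, x) \<in> le})"
        by (intro big_image[OF eX]) (auto simp: big_def)
      moreover have "e ` {x \<in> X. (y, x) \<in> le} \<subseteq> I (e y) x0"
        using e that unfolding I_def embedding_def by auto
      ultimately show False
        using bounded big_mono by blast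
    qed
    \<comment> \<open>In the reversed order the final segments become initial ones.\<close>
    then have "isomorphic X (le\<inverse>) UNIV omega_le"
      using lin canon_nat
      by (intro isomorphic_omega_if_short_initial_segments[OF _ cnt inf])
        (simp_all add: embedding_converse embeds_converse)
    then show ?thesis
      using isomorphic_converse[of X le UNIV "omega_le\<inverse>"] by simp
  qed
qed

theorem theorem3p12:
  fixes X :: "'a set" and le :: "'a rel"
  assumes "linear_order_on X le"
    and "countable X" and "infinite X"
    and "infinite (UNIV :: 'b set)"
  shows "(n_sunflowerable TYPE('b) 2 X le \<longleftrightarrow> sunflowerable TYPE('b) X le) \<and>
    (sunflowerable TYPE('b) X le \<longleftrightarrow>
       isomorphic X le (UNIV :: nat set) omega_le \<or>
       isomorphic X le (UNIV :: nat set) (omega_le\<inverse>) \<or>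
       embeds (UNIV :: rat set) rat_le X le)"
proof -
  have "n_sunflowerable TYPE('b) 2 X le" if "sunflowerable TYPE('b) X le"
    using that unfolding sunflowerable_def by blast
  moreover have "isomorphic X le (UNIV :: nat set) omega_le \<or>
      isomorphic X le (UNIV :: nat set) (omega_le\<inverse>) \<or> embeds (UNIV :: rat set) rat_le X le"
    if sf: "n_sunflowerable TYPE('b) 2 X le"
  proof (cases "embeds (UNIV :: rat set) rat_le X le")
    case False
    have "isomorphic X le (UNIV :: nat set) omega_le \<or> isomorphic X le (UNIV :: nat set) (omega_le\<inverse>)"
      by (rule cases_if_canonical[OF assms(1-3) _ _ False];
          rule canonical_if_2_sunflowerable[OF sf assms(2-4)])
    then show ?thesis
      by blast
  qed simp
  ultimately show ?thesis
    using sunflowerable_cases[OF assms(1,2)] by metis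
qed

end
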